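(* Let $X,Y$ be independent real-valued continuous random variables, let $(X_0,Y_0),(X_1,Y_1),\dots,(X_n,Y_n)$ be i.i.d. copies of $(X,Y)$, and set $S_i=X_i+Y_i$ for $i=0,\dots,n$. Then $$h(S_0+S_1+\cdots+S_n)\leq(2n+1)h(X+Y)-n\,h(X)-n\,h(Y).$$
   Context: Standing conventions: random variables are real-valued with densities and all differential entropies $h$ appearing exist and are finite. *)

theory Defs
  imports "HOL-Probability.Probability"
begin

definition diff_entropy :: "'a measure \<Rightarrow> ('a \<Rightarrow> real) \<Rightarrow> real" where
  "diff_entropy M X = prob_space.entropy M (exp 1) lborel X"

definition has_finite_diff_entropy :: "'a measure \<Rightarrow> ('a \<Rightarrow> real) \<Rightarrow> bool" where
  "has_finite_diff_entropy M X \<longleftrightarrow>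
     (\<exists>f. information_space.finite_entropy M (exp 1) lborel X f)"

end

theory Submission
  imports Defs
begin

text \<open>
  Let \<open>Z\<^sub>0, \<dots>, Z\<^sub>N\<close> be independent, \<open>W\<^sub>m = Z\<^sub>0 + \<dots> + Z\<^sub>m\<close>, and let \<open>w\<^sub>m\<close>, \<open>z\<^sub>m\<close>, \<open>s\<^sub>m\<close> be the densities of
  \<open>W\<^sub>m\<close>, \<open>Z\<^sub>m\<close>, \<open>Z\<^sub>m + Z\<^sub>m\<^sub>+\<^sub>1\<close>. By Fubini and the convolution formula the ratio
  \<open>R\<^sub>m = w\<^sub>m(W\<^sub>m) s\<^sub>m(Z\<^sub>m + Z\<^sub>m\<^sub>+\<^sub>1) / (z\<^sub>m(Z\<^sub>m) w\<^sub>m\<^sub>+\<^sub>1(W\<^sub>m\<^sub>+\<^sub>1))\<close> has expectation at most 1. Summing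
  \<open>ln R\<^sub>m \<le> R\<^sub>m - 1\<close> over \<open>1 \<le> m < N\<close>, the terms \<open>ln w\<^sub>m(W\<^sub>m)\<close> telescope pointwise, so that
  \<open>h(W\<^sub>N) + h(Z\<^sub>1) + \<dots> + h(Z\<^sub>N\<^sub>-\<^sub>1) \<le> h(Z\<^sub>0 + Z\<^sub>1) + \<dots> + h(Z\<^sub>N\<^sub>-\<^sub>1 + Z\<^sub>N)\<close>
  without any integrability of the intermediate \<open>ln w\<^sub>m(W\<^sub>m)\<close>. The theorem is the case of the
  sequence \<open>X\<^sub>0, Y\<^sub>0, X\<^sub>1, Y\<^sub>1, \<dots>, X\<^sub>n, Y\<^sub>n\<close>, all of whose adjacent sums are distributed like \<open>X + Y\<close>.
\<close>

section \<open>Integration against the law of an independent pair\<close>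

lemma nn_integral_lborel_shift:
  fixes f :: "real \<Rightarrow> ennreal"
  assumes "f \<in> borel_measurable borel"
  shows "(\<integral>\<^sup>+x. f (x + c) \<partial>lborel) = (\<integral>\<^sup>+x. f x \<partial>lborel)"
  using nn_integral_real_affine[OF assms, of 1 c] by (simp add: add.commute)

context prob_space
begin

text \<open>Independence enters as an equality of laws rather than as \<open>indep_var\<close>, so
  that \<open>X\<close> and \<open>Y\<close> may take values in different types, as \<open>B\<close>
  and the pair \<open>(A, C)\<close> do in the ratio bound. Tonelli on the product law lets the two
  sample points be drawn separately.\<close>

lemma nn_integral_product_law:
  assumes [measurable]: "X \<in> measurable M S" "Y \<in> measurable M T"
    and eq: "distr M S X \<Otimes>\<^sub>M distr M T Y = distr M (S \<Otimes>\<^sub>M T) (\<lambda>\<omega>. (X \<omega>, Y \<omega>))"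
    and [measurable]: "f \<in> borel_measurable (S \<Otimes>\<^sub>M T)"
  shows "(\<integral>\<^sup>+\<omega>. f (X \<omega>, Y \<omega>) \<partial>M) = (\<integral>\<^sup>+\<omega>'. \<integral>\<^sup>+\<omega>. f (X \<omega>, Y \<omega>') \<partial>M \<partial>M)"
proof -
  interpret X: prob_space "distr M S X" by (rule prob_space_distr) simp
  interpret Y: prob_space "distr M T Y" by (rule prob_space_distr) simp
  interpret XY: pair_sigma_finite "distr M S X" "distr M T Y" ..
  have "(\<integral>\<^sup>+\<omega>. f (X \<omega>, Y \<omega>) \<partial>M) = (\<integral>\<^sup>+p. f p \<partial>distr M (S \<Otimes>\<^sub>M T) (\<lambda>x. (X x, Y x)))"
    by (simp add: nn_integral_distr)
  also have "\<dots> = (\<integral>\<^sup>+y. \<integral>\<^sup>+x. f (x, y) \<partial>distr M S X \<partial>distr M T Y)"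
    unfolding eq[symmetric] by (rule XY.nn_integral_snd[symmetric]) simp
  also have "\<dots> = (\<integral>\<^sup>+y. \<integral>\<^sup>+\<omega>. f (X \<omega>, y) \<partial>M \<partial>distr M T Y)"
    by (intro nn_integral_cong) (simp add: nn_integral_distr)
  also have "\<dots> = (\<integral>\<^sup>+\<omega>'. \<integral>\<^sup>+\<omega>. f (X \<omega>, Y \<omega>') \<partial>M \<partial>M)"
    by (simp add: nn_integral_distr)
  finally show ?thesis .
qed

lemma nn_integral_product_law_density:
  assumes X: "distributed M lborel X f" and [measurable]: "Y \<in> measurable M T"
    and eq: "distr M borel X \<Otimes>\<^sub>M distr M T Y = distr M (borel \<Otimes>\<^sub>M T) (\<lambda>\<omega>. (X \<omega>, Y \<omega>))"
    and [measurable]: "g \<in> borel_measurable (borel \<Otimes>\<^sub>M T)"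
  shows "(\<integral>\<^sup>+\<omega>. g (X \<omega>, Y \<omega>) \<partial>M) = (\<integral>\<^sup>+\<omega>. \<integral>\<^sup>+x. f x * g (x, Y \<omega>) \<partial>lborel \<partial>M)"
proof -
  have [measurable]: "X \<in> borel_measurable M"
    using distributed_measurable[OF X] by simp
  have [measurable]: "(\<lambda>x. g (x, Y \<omega>)) \<in> borel_measurable borel" if "\<omega> \<in> space M" for \<omega>
    using that by measurable
  have "(\<integral>\<^sup>+\<omega>. g (X \<omega>, Y \<omega>) \<partial>M) = (\<integral>\<^sup>+\<omega>'. \<integral>\<^sup>+\<omega>. g (X \<omega>, Y \<omega>') \<partial>M \<partial>M)"
    by (rule nn_integral_product_law[OF _ _ eq]) simp_all
  also have "\<dots> = (\<integral>\<^sup>+\<omega>. \<integral>\<^sup>+x. f x * g (x, Y \<omega>) \<partial>lborel \<partial>M)"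
    by (intro nn_integral_cong distributed_nn_integral[OF X, symmetric]) simp
  finally show ?thesis .
qed

text \<open>Turns independence of two blocks of coordinates into the product-law form, with
  \<open>f\<close> and \<open>g\<close> reading the blocks into possibly different types.\<close>

lemma product_law_indep_var_compose:
  assumes ind: "indep_var S X T Y" and [measurable]: "f \<in> measurable S S'" "g \<in> measurable T T'"
  shows "distr M S' (\<lambda>\<omega>. f (X \<omega>)) \<Otimes>\<^sub>M distr M T' (\<lambda>\<omega>. g (Y \<omega>))
    = distr M (S' \<Otimes>\<^sub>M T') (\<lambda>\<omega>. (f (X \<omega>), g (Y \<omega>)))"
proof -
  have [measurable]: "X \<in> measurable M S" "Y \<in> measurable M T"
    and eq: "distr M S X \<Otimes>\<^sub>M distr M T Y = distr M (S \<Otimes>\<^sub>M T) (\<lambda>\<omega>. (X \<omega>, Y \<omega>))"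
    using ind unfolding indep_var_distribution_eq by auto
  interpret gY: prob_space "distr (distr M T Y) T' g"
    by (intro prob_space.prob_space_distr prob_space_distr) simp_all
  have "distr (distr M S X) S' f \<Otimes>\<^sub>M distr (distr M T Y) T' g
      = distr (distr M S X \<Otimes>\<^sub>M distr M T Y) (S' \<Otimes>\<^sub>M T') (\<lambda>(x, y). (f x, g y))"
    by (rule pair_measure_distr) (simp_all add: gY.sigma_finite_measure_axioms)
  then show ?thesis
    by (simp add: eq distr_distr comp_def)
qed

section \<open>Convolution and real-valued densities\<close>

text \<open>The convolution is an expectation over \<open>Y\<close> rather than an integral against
  a density of \<open>Y\<close>, so the law of \<open>Y\<close> may be arbitrary. For fixed
  \<open>Y \<omega>\<close>, Lebesgue measure is translated; then the integrals are
  exchanged.\<close>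

lemma distributed_add_indep_var:
  assumes ind: "indep_var borel X borel Y" and X: "distributed M lborel X f"
  shows "distributed M lborel (\<lambda>\<omega>. X \<omega> + Y \<omega> :: real) (\<lambda>w. \<integral>\<^sup>+\<omega>. f (w - Y \<omega>) \<partial>M)"
proof -
  have [measurable]: "X \<in> borel_measurable M" "Y \<in> borel_measurable M"
    using indep_var_rv1[OF ind] indep_var_rv2[OF ind] by auto
  have [measurable]: "f \<in> borel_measurable borel"
    using distributed_borel_measurable[OF X] by simp
  have law: "distr M borel X \<Otimes>\<^sub>M distr M borel Y = distr M (borel \<Otimes>\<^sub>M borel) (\<lambda>\<omega>. (X \<omega>, Y \<omega>))"
    using ind unfolding indep_var_distribution_eq by simp
  interpret P: pair_sigma_finite M lborel ..
  have "distr M lborel (\<lambda>\<omega>. X \<omega> + Y \<omega>) = density lborel (\<lambda>w. \<integral>\<^sup>+\<omega>. f (w - Y \<omega>) \<partial>M)"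
  proof (rule measure_eqI)
    fix A assume "A \<in> sets (distr M lborel (\<lambda>\<omega>. X \<omega> + Y \<omega>))"
    then have [measurable]: "A \<in> sets borel" by simp
    have "emeasure (distr M lborel (\<lambda>\<omega>. X \<omega> + Y \<omega>)) A
        = (\<integral>\<^sup>+z. indicator A z \<partial>distr M lborel (\<lambda>\<omega>. X \<omega> + Y \<omega>))"
      by simp
    also have "\<dots> = (\<integral>\<^sup>+\<omega>. (\<lambda>(x, y). indicator A (x + y)) (X \<omega>, Y \<omega>) \<partial>M)"
      by (subst nn_integral_distr) auto
    also have "\<dots> = (\<integral>\<^sup>+\<omega>. \<integral>\<^sup>+x. f x * indicator A (x + Y \<omega>) \<partial>lborel \<partial>M)"
      by (subst nn_integral_product_law_density[OF X _ law]) auto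
    also have "\<dots> = (\<integral>\<^sup>+\<omega>. \<integral>\<^sup>+w. f (w - Y \<omega>) * indicator A w \<partial>lborel \<partial>M)"
    proof (rule nn_integral_cong)
      fix \<omega>
      show "(\<integral>\<^sup>+x. f x * indicator A (x + Y \<omega>) \<partial>lborel) = (\<integral>\<^sup>+w. f (w - Y \<omega>) * indicator A w \<partial>lborel)"
        using nn_integral_lborel_shift[of "\<lambda>w. f (w - Y \<omega>) * indicator A w" "Y \<omega>"] by simp
    qed
    also have "\<dots> = (\<integral>\<^sup>+w. \<integral>\<^sup>+\<omega>. f (w - Y \<omega>) * indicator A w \<partial>M \<partial>lborel)"
      by (rule P.Fubini'[symmetric]) simp
    also have "\<dots> = emeasure (density lborel (\<lambda>w. \<integral>\<^sup>+\<omega>. f (w - Y \<omega>) \<partial>M)) A"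
      by (simp add: emeasure_density nn_integral_multc)
    finally show "emeasure (distr M lborel (\<lambda>\<omega>. X \<omega> + Y \<omega>)) A
        = emeasure (density lborel (\<lambda>w. \<integral>\<^sup>+\<omega>. f (w - Y \<omega>) \<partial>M)) A" .
  qed simp
  then show ?thesis by (simp add: distributed_def)
qed

text \<open>A density has total mass 1, so it is finite almost everywhere and
  \<open>enn2real\<close> alters it only on a null set.\<close>

lemma distributed_real_density:
  assumes X: "distributed M S X f"
  shows "\<exists>g :: _ \<Rightarrow> real. (\<forall>x. 0 \<le> g x) \<and> distributed M S X (\<lambda>x. ennreal (g x))"
proof (intro exI conjI allI)
  have [measurable]: "f \<in> borel_measurable S" and XM[measurable]: "X \<in> measurable M S"
    using X by (auto simp: distributed_def)
  have "(\<integral>\<^sup>+x. f x \<partial>S) = 1"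
    using distributed_nn_integral[OF X, of "\<lambda>_. 1"] by (simp add: emeasure_space_1)
  then have "AE x in S. f x \<noteq> \<infinity>"
    by (intro nn_integral_PInf_AE) auto
  then have "AE x in S. f x = ennreal (enn2real (f x))"
    by eventually_elim (simp add: less_top)
  then show "distributed M S X (\<lambda>x. ennreal (enn2real (f x)))"
    using X by (subst distributed_cong_density[symmetric]) auto
qed simp

text \<open>A law gives no mass to the zero set of its own density. This is what permits splitting
  logarithms of products and quotients of densities evaluated at their own variables.\<close>

lemma distributed_AE_pos:
  assumes X: "distributed M S X (\<lambda>x. ennreal (f x))"
  shows "AE \<omega> in M. 0 < f (X \<omega>)"
proof -
  have "AE x in distr M S X. 0 < f x"
    using X by (subst distributed_distr_eq_density[OF X], subst AE_density)
      (auto simp: distributed_def ennreal_less_zero_iff)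
  then show ?thesis
    by (rule AE_distrD[OF distributed_measurable[OF X]])
qed

section \<open>The expected density ratio\<close>

text \<open>Integrating \<open>B\<close> against its density cancels \<open>f\<^sub>B\<close>. In
  the variable \<open>w = A + B + C\<close> the numerator is
  \<open>f\<^sub>A\<^sub>B (w - C) * f\<^sub>B\<^sub>C (w - A)\<close>; as \<open>A\<close> and
  \<open>C\<close> are independent, its mean factors into two convolutions, each equal to
  \<open>f w\<close>. Dividing by \<open>f w\<close> leaves \<open>f w\<close>, of mass 1.\<close>

lemma nn_integral_density_ratio_le_1:
  fixes V :: "nat \<Rightarrow> 'a \<Rightarrow> real" and f\<^sub>B f\<^sub>A\<^sub>B f\<^sub>B\<^sub>C f :: "real \<Rightarrow> real"
  defines "A \<equiv> V 0" and "B \<equiv> V 1" and "C \<equiv> V 2"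
  assumes ind: "indep_vars (\<lambda>_. borel) V {0, 1, 2}"
    and nn: "\<And>x. 0 \<le> f\<^sub>B x" "\<And>x. 0 \<le> f\<^sub>A\<^sub>B x" "\<And>x. 0 \<le> f\<^sub>B\<^sub>C x" "\<And>x. 0 \<le> f x"
    and dB: "distributed M lborel B (\<lambda>x. ennreal (f\<^sub>B x))"
    and dAB: "distributed M lborel (\<lambda>\<omega>. A \<omega> + B \<omega>) (\<lambda>x. ennreal (f\<^sub>A\<^sub>B x))"
    and dBC: "distributed M lborel (\<lambda>\<omega>. B \<omega> + C \<omega>) (\<lambda>x. ennreal (f\<^sub>B\<^sub>C x))"
    and d: "distributed M lborel (\<lambda>\<omega>. A \<omega> + B \<omega> + C \<omega>) (\<lambda>x. ennreal (f x))"
  shows "(\<integral>\<^sup>+\<omega>. ennreal (f\<^sub>A\<^sub>B (A \<omega> + B \<omega>) * f\<^sub>B\<^sub>C (B \<omega> + C \<omega>)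
           / (f\<^sub>B (B \<omega>) * f (A \<omega> + B \<omega> + C \<omega>))) \<partial>M) \<le> 1"
proof -
  have [measurable]: "A \<in> borel_measurable M" "B \<in> borel_measurable M" "C \<in> borel_measurable M"
    using ind by (auto simp: indep_vars_def A_def B_def C_def)
  \<comment> \<open>\<open>B\<close> comes first because it is integrated against its density while
    the pair \<open>(A, C)\<close> is held fixed.\<close>
  have lawB: "distr M borel B \<Otimes>\<^sub>M distr M (borel \<Otimes>\<^sub>M borel) (\<lambda>\<omega>. (A \<omega>, C \<omega>))
      = distr M (borel \<Otimes>\<^sub>M borel \<Otimes>\<^sub>M borel) (\<lambda>\<omega>. (B \<omega>, A \<omega>, C \<omega>))"
    using product_law_indep_var_compose[OF indep_var_restrict[OF ind, of "{1}" "{0, 2}"],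
        of "\<lambda>v. v 1" borel "\<lambda>v. (v 0, v 2)" "borel \<Otimes>\<^sub>M borel"]
    by (simp add: A_def B_def C_def)
  have lawAC: "distr M borel A \<Otimes>\<^sub>M distr M borel C
      = distr M (borel \<Otimes>\<^sub>M borel) (\<lambda>\<omega>. (A \<omega>, C \<omega>))"
    using product_law_indep_var_compose[OF indep_var_restrict[OF ind, of "{0}" "{2}"],
        of "\<lambda>v. v 0" borel "\<lambda>v. v 2" borel]
    by (simp add: A_def C_def)
  have indAB: "indep_var borel (\<lambda>\<omega>. A \<omega> + B \<omega>) borel C"
    using indep_var_compose[OF indep_var_restrict[OF ind, of "{0, 1}" "{2}"],
        of "\<lambda>v. v 0 + v 1" borel "\<lambda>v. v 2" borel]
    by (simp add: A_def B_def C_def comp_def)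
  have indBC: "indep_var borel (\<lambda>\<omega>. B \<omega> + C \<omega>) borel A"
    using indep_var_compose[OF indep_var_restrict[OF ind, of "{1, 2}" "{0}"],
        of "\<lambda>v. v 1 + v 2" borel "\<lambda>v. v 0" borel]
    by (simp add: A_def B_def C_def comp_def)
  have [measurable]: "f\<^sub>B \<in> borel_measurable borel" "f\<^sub>A\<^sub>B \<in> borel_measurable borel"
      "f\<^sub>B\<^sub>C \<in> borel_measurable borel" "f \<in> borel_measurable borel"
    using distributed_real_measurable[OF nn(1) dB] distributed_real_measurable[OF nn(2) dAB]
      distributed_real_measurable[OF nn(3) dBC] distributed_real_measurable[OF nn(4) d] by auto
  interpret P: pair_sigma_finite M lborel ..
  \<comment> \<open>The integrand after substituting \<open>w = a + y + c\<close>, so that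
    \<open>a + y = w - c\<close> and \<open>y + c = w - a\<close>, with \<open>f\<^sub>B\<close>
    cancelled.\<close>
  define G where "G a c w = ennreal (1 / f w) * (ennreal (f\<^sub>A\<^sub>B (w - c)) * ennreal (f\<^sub>B\<^sub>C (w - a)))" for a c w
  have [measurable]: "(\<lambda>(a, c, w). G a c w) \<in> borel_measurable (borel \<Otimes>\<^sub>M borel \<Otimes>\<^sub>M borel)"
    unfolding G_def by measurable
  \<comment> \<open>Equality holds unless \<open>f\<^sub>B y = 0\<close>; there the left side is 0
    and the right side only nonnegative.\<close>
  have cancel: "ennreal (f\<^sub>B y) * ennreal (f\<^sub>A\<^sub>B (a + y) * f\<^sub>B\<^sub>C (y + c) / (f\<^sub>B y * f (a + y + c)))
      \<le> G a c (y + (a + c))" for a c y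
  proof -
    have "f\<^sub>B y * (f\<^sub>A\<^sub>B (a + y) * f\<^sub>B\<^sub>C (y + c) / (f\<^sub>B y * f (a + y + c)))
        \<le> 1 / f (a + y + c) * (f\<^sub>A\<^sub>B (a + y) * f\<^sub>B\<^sub>C (y + c))"
      using nn by (cases "f\<^sub>B y = 0") auto
    then show ?thesis
      unfolding G_def using nn
      by (simp add: ennreal_mult[symmetric] add_ac del: times_divide_eq_right times_divide_eq_left)
  qed
  \<comment> \<open>The total sum is read as \<open>(A + B) + C\<close> here and as
    \<open>(B + C) + A\<close> in \<open>conv2\<close>; both convolutions are densities of the same
    law as \<open>f\<close>, hence equal to it almost everywhere.\<close>
  have conv1: "AE w in lborel. (\<integral>\<^sup>+\<omega>. ennreal (f\<^sub>A\<^sub>B (w - C \<omega>)) \<partial>M) = ennreal (f w)"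
    by (rule distributed_unique[OF distributed_add_indep_var[OF indAB dAB] d])
  have d': "distributed M lborel (\<lambda>\<omega>. B \<omega> + C \<omega> + A \<omega>) (\<lambda>x. ennreal (f x))"
    using d by (simp add: add_ac)
  have conv2: "AE w in lborel. (\<integral>\<^sup>+\<omega>. ennreal (f\<^sub>B\<^sub>C (w - A \<omega>)) \<partial>M) = ennreal (f w)"
    by (rule distributed_unique[OF distributed_add_indep_var[OF indBC dBC] d'])
  have "(\<integral>\<^sup>+\<omega>. ennreal (f\<^sub>A\<^sub>B (A \<omega> + B \<omega>) * f\<^sub>B\<^sub>C (B \<omega> + C \<omega>)
           / (f\<^sub>B (B \<omega>) * f (A \<omega> + B \<omega> + C \<omega>))) \<partial>M)
      = (\<integral>\<^sup>+\<omega>. (\<lambda>(y, a, c). ennreal (f\<^sub>A\<^sub>B (a + y) * f\<^sub>B\<^sub>C (y + c)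
           / (f\<^sub>B y * f (a + y + c)))) (B \<omega>, A \<omega>, C \<omega>) \<partial>M)"
    by simp
  also have "\<dots> = (\<integral>\<^sup>+\<omega>. \<integral>\<^sup>+y. ennreal (f\<^sub>B y) * ennreal (f\<^sub>A\<^sub>B (A \<omega> + y) * f\<^sub>B\<^sub>C (y + C \<omega>)
           / (f\<^sub>B y * f (A \<omega> + y + C \<omega>))) \<partial>lborel \<partial>M)"
    by (subst nn_integral_product_law_density[OF dB _ lawB]) auto
  also have "\<dots> \<le> (\<integral>\<^sup>+\<omega>. \<integral>\<^sup>+y. G (A \<omega>) (C \<omega>) (y + (A \<omega> + C \<omega>)) \<partial>lborel \<partial>M)"
    by (intro nn_integral_mono cancel)
  also have "\<dots> = (\<integral>\<^sup>+\<omega>. \<integral>\<^sup>+w. G (A \<omega>) (C \<omega>) w \<partial>lborel \<partial>M)"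
    by (intro nn_integral_cong nn_integral_lborel_shift) simp
  also have "\<dots> = (\<integral>\<^sup>+w. \<integral>\<^sup>+\<omega>. (\<lambda>(a, c). G a c w) (A \<omega>, C \<omega>) \<partial>M \<partial>lborel)"
    by (simp, rule P.Fubini'[symmetric]) (unfold G_def, measurable)
  \<comment> \<open>For fixed \<open>w\<close> one factor depends only on \<open>C\<close> and the
    other only on \<open>A\<close>, so with separate sample points the double integral becomes a
    product.\<close>
  also have "\<dots> = (\<integral>\<^sup>+w. \<integral>\<^sup>+\<omega>'. \<integral>\<^sup>+\<omega>. G (A \<omega>) (C \<omega>') w \<partial>M \<partial>M \<partial>lborel)"
    by (subst nn_integral_product_law[OF _ _ lawAC]) (auto simp: G_def)
  also have "\<dots> = (\<integral>\<^sup>+w. ennreal (1 / f w) * ((\<integral>\<^sup>+\<omega>. ennreal (f\<^sub>A\<^sub>B (w - C \<omega>)) \<partial>M)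
      * (\<integral>\<^sup>+\<omega>. ennreal (f\<^sub>B\<^sub>C (w - A \<omega>)) \<partial>M)) \<partial>lborel)"
    unfolding G_def by (simp add: nn_integral_cmult nn_integral_multc)
  also have "\<dots> = (\<integral>\<^sup>+w. ennreal (1 / f w) * (ennreal (f w) * ennreal (f w)) \<partial>lborel)"
  proof (rule nn_integral_cong_AE)
    show "AE w in lborel. ennreal (1 / f w) * ((\<integral>\<^sup>+\<omega>. ennreal (f\<^sub>A\<^sub>B (w - C \<omega>)) \<partial>M)
      * (\<integral>\<^sup>+\<omega>. ennreal (f\<^sub>B\<^sub>C (w - A \<omega>)) \<partial>M)) = ennreal (1 / f w) * (ennreal (f w) * ennreal (f w))"
      using conv1 conv2 by eventually_elim simp
  qed
  also have "\<dots> \<le> (\<integral>\<^sup>+w. ennreal (f w) \<partial>lborel)"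
  proof (rule nn_integral_mono)
    fix w
    \<comment> \<open>The convention \<open>1 / 0 = 0\<close> covers the points where
      \<open>f\<close> vanishes.\<close>
    have "1 / f w * (f w * f w) \<le> f w" by simp
    then show "ennreal (1 / f w) * (ennreal (f w) * ennreal (f w)) \<le> ennreal (f w)"
      using nn by (simp add: ennreal_mult[symmetric])
  qed
  also have "\<dots> = 1"
    using distributed_nn_integral[OF d, of "\<lambda>_. 1"] by (simp add: emeasure_space_1)
  finally show ?thesis .
qed


section \<open>Differential entropy as an expected log-density\<close>

lemma has_finite_diff_entropy_density:
  assumes "has_finite_diff_entropy M X"
  shows "\<exists>f :: real \<Rightarrow> real. (\<forall>x. 0 \<le> f x) \<and> distributed M lborel X (\<lambda>x. ennreal (f x))"
proof -
  interpret information_space M "exp 1" by standard simp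
  show ?thesis
    using assms unfolding has_finite_diff_entropy_def finite_entropy_def by auto
qed

text \<open>The given \<open>f\<close> may differ from the density that witnesses finiteness, but
  the two agree almost everywhere, so integrability carries over. Passing from \<open>lborel\<close>
  to \<open>M\<close> allows log-densities of different variables to be added pointwise.\<close>

lemma
  assumes fin: "has_finite_diff_entropy M X"
    and X: "distributed M lborel X (\<lambda>x. ennreal (f x))" and nn: "\<And>x. 0 \<le> f x"
  shows integrable_ln_density: "integrable M (\<lambda>\<omega>. ln (f (X \<omega>)))"
    and diff_entropy_eq_expectation: "diff_entropy M X = - (\<integral>\<omega>. ln (f (X \<omega>)) \<partial>M)"
proof -
  interpret information_space M "exp 1" by standard simp
  obtain g where g: "distributed M lborel X (\<lambda>x. ennreal (g x))" "\<And>x. 0 \<le> g x"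
    and int: "integrable lborel (\<lambda>x. g x * ln (g x))"
    using fin unfolding has_finite_diff_entropy_def finite_entropy_def by (auto simp: log_ln)
  have [measurable]: "f \<in> borel_measurable borel" "g \<in> borel_measurable borel"
    using distributed_real_measurable[OF nn X] distributed_real_measurable[OF g(2,1)] by auto
  have "AE x in lborel. ennreal (g x) = ennreal (f x)"
    by (rule distributed_unique[OF g(1) X])
  then have "AE x in lborel. g x * ln (g x) = f x * ln (f x)"
    using g(2) nn by (auto elim!: eventually_mono)
  then have "integrable lborel (\<lambda>x. f x * ln (f x))"
    by (intro integrable_cong_AE_imp[OF int]) auto
  then show "integrable M (\<lambda>\<omega>. ln (f (X \<omega>)))"
    using distributed_integrable[OF X, of "\<lambda>x. ln (f x)"] nn by simp
  have "diff_entropy M X = - (\<integral>x. f x * ln (f x) \<partial>lborel)"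
    unfolding diff_entropy_def using entropy_distr[OF X] nn by (simp add: log_ln)
  also have "(\<integral>x. f x * ln (f x) \<partial>lborel) = (\<integral>\<omega>. ln (f (X \<omega>)) \<partial>M)"
    using distributed_integral[OF X, of "\<lambda>x. ln (f x)"] nn by simp
  finally show "diff_entropy M X = - (\<integral>\<omega>. ln (f (X \<omega>)) \<partial>M)" .
qed

lemma
  assumes [measurable]: "X \<in> borel_measurable M" "X' \<in> borel_measurable M"
    and eq: "distr M borel X = distr M borel X'"
  shows diff_entropy_cong_law: "diff_entropy M X = diff_entropy M X'"
    and has_finite_diff_entropy_cong_law: "has_finite_diff_entropy M X \<longleftrightarrow> has_finite_diff_entropy M X'"
proof -
  interpret information_space M "exp 1" by standard simp
  \<comment> \<open>\<open>lborel\<close> and \<open>borel\<close> have the same measurable sets,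
    and both notions see \<open>X\<close> only through this law.\<close>
  have "distr M lborel X = distr M borel X" "distr M lborel X' = distr M borel X'"
    by (auto intro: distr_cong)
  then have eq': "distr M lborel X = distr M lborel X'"
    using eq by simp
  then show "diff_entropy M X = diff_entropy M X'"
    by (simp add: diff_entropy_def entropy_def)
  show "has_finite_diff_entropy M X \<longleftrightarrow> has_finite_diff_entropy M X'"
    using eq' by (simp add: has_finite_diff_entropy_def finite_entropy_def distributed_def)
qed

section \<open>Block sums and partial sums of independent variables\<close>

lemma indep_vars_disjoint_sums:
  fixes Z :: "'i \<Rightarrow> 'a \<Rightarrow> real"
  assumes ind: "indep_vars (\<lambda>_. borel) Z I" and K: "\<And>j. j \<in> J \<Longrightarrow> K j \<subseteq> I"
    and disj: "disjoint_family_on K J"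
  shows "indep_vars (\<lambda>_. borel) (\<lambda>j \<omega>. \<Sum>i\<in>K j. Z i \<omega>) J"
proof -
  have "indep_vars (\<lambda>_. borel) (\<lambda>j \<omega>. (\<lambda>v. \<Sum>i\<in>K j. v i) (restrict (\<lambda>i. Z i \<omega>) (K j))) J"
    by (rule indep_vars_compose2[OF indep_vars_restrict[OF ind K disj]]) auto
  then show ?thesis by simp
qed

text \<open>The induction starts at \<open>Z 0 + Z 1\<close>, whose density is given. Each further
  summand is independent of the partial sum so far, and convolution supplies the next
  density.\<close>

lemma indep_vars_partial_sum_density:
  fixes Z :: "nat \<Rightarrow> 'a \<Rightarrow> real"
  assumes ind: "indep_vars (\<lambda>_. borel) Z {..N}"
    and base: "distributed M lborel (\<lambda>\<omega>. Z 0 \<omega> + Z 1 \<omega>) f" and m: "1 \<le> m" "m \<le> N"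
  shows "\<exists>g. distributed M lborel (\<lambda>\<omega>. \<Sum>i\<le>m. Z i \<omega>) g"
  using m
proof (induction m rule: dec_induct)
  case base
  show ?case using assms(2) by auto
next
  case (step m)
  then obtain g where g: "distributed M lborel (\<lambda>\<omega>. \<Sum>i\<le>m. Z i \<omega>) g" by auto
  \<comment> \<open>The blocks are indexed by booleans because \<open>indep_var\<close> is
    \<open>indep_vars\<close> over the type \<open>bool\<close>.\<close>
  have "indep_vars (\<lambda>_. borel) (\<lambda>j \<omega>. \<Sum>i\<in>(if j then {..m} else {Suc m}). Z i \<omega>) UNIV"
    using step by (intro indep_vars_disjoint_sums[OF ind]) (auto simp: disjoint_family_on_def)
  then have "indep_var borel (\<lambda>\<omega>. \<Sum>i\<le>m. Z i \<omega>) borel (Z (Suc m))"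
    unfolding indep_var_def by (rule indep_vars_cong[THEN iffD1, rotated -1]) (auto split: bool.split)
  from distributed_add_indep_var[OF this g] show ?case by auto
qed

section \<open>The chain inequality for adjacent sums\<close>

text \<open>The finiteness hypotheses concern exactly the log-densities that survive the
  telescoping: the interior \<open>Z j\<close>, the adjacent sums and the full sum.\<close>

theorem diff_entropy_sum_chain:
  fixes Z :: "nat \<Rightarrow> 'a \<Rightarrow> real"
  assumes ind: "indep_vars (\<lambda>_. borel) Z {..N}" and N: "1 \<le> N"
    and finZ: "\<And>j. 1 \<le> j \<Longrightarrow> j < N \<Longrightarrow> has_finite_diff_entropy M (Z j)"
    and finS: "\<And>j. j < N \<Longrightarrow> has_finite_diff_entropy M (\<lambda>\<omega>. Z j \<omega> + Z (Suc j) \<omega>)"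
    and finT: "has_finite_diff_entropy M (\<lambda>\<omega>. \<Sum>i\<le>N. Z i \<omega>)"
  shows "diff_entropy M (\<lambda>\<omega>. \<Sum>i\<le>N. Z i \<omega>) + (\<Sum>j=1..<N. diff_entropy M (Z j))
    \<le> (\<Sum>j<N. diff_entropy M (\<lambda>\<omega>. Z j \<omega> + Z (Suc j) \<omega>))"
proof -
  define W where "W m \<omega> = (\<Sum>i\<le>m. Z i \<omega>)" for m \<omega>
  have W_Suc: "W (Suc m) \<omega> = W m \<omega> + Z (Suc m) \<omega>" for m \<omega>
    by (simp add: W_def)
  \<comment> \<open>Outside the relevant range the zero function is a dummy value, so that choice
    yields a family nonnegative at every index. The same is done for \<open>s\<close> and
    \<open>w\<close>.\<close>
  have "\<exists>f :: real \<Rightarrow> real. (\<forall>x. 0 \<le> f x) \<and>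
      (1 \<le> j \<and> j < N \<longrightarrow> distributed M lborel (Z j) (\<lambda>x. ennreal (f x)))" for j
    using has_finite_diff_entropy_density[OF finZ, of j]
    by (cases "1 \<le> j \<and> j < N") (auto intro: exI[of _ "\<lambda>_. 0"])
  then have "\<exists>z :: nat \<Rightarrow> real \<Rightarrow> real. \<forall>j. (\<forall>x. 0 \<le> z j x) \<and>
      (1 \<le> j \<and> j < N \<longrightarrow> distributed M lborel (Z j) (\<lambda>x. ennreal (z j x)))"
    by (intro choice allI)
  then obtain z :: "nat \<Rightarrow> real \<Rightarrow> real" where z_nn: "\<And>j x. 0 \<le> z j x"
    and z: "\<And>j. 1 \<le> j \<Longrightarrow> j < N \<Longrightarrow> distributed M lborel (Z j) (\<lambda>x. ennreal (z j x))"
    by blast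
  have "\<exists>f :: real \<Rightarrow> real. (\<forall>x. 0 \<le> f x) \<and>
      (j < N \<longrightarrow> distributed M lborel (\<lambda>\<omega>. Z j \<omega> + Z (Suc j) \<omega>) (\<lambda>x. ennreal (f x)))" for j
    using has_finite_diff_entropy_density[OF finS, of j]
    by (cases "j < N") (auto intro: exI[of _ "\<lambda>_. 0"])
  then have "\<exists>s :: nat \<Rightarrow> real \<Rightarrow> real. \<forall>j. (\<forall>x. 0 \<le> s j x) \<and>
      (j < N \<longrightarrow> distributed M lborel (\<lambda>\<omega>. Z j \<omega> + Z (Suc j) \<omega>) (\<lambda>x. ennreal (s j x)))"
    by (intro choice allI)
  then obtain s :: "nat \<Rightarrow> real \<Rightarrow> real" where s_nn: "\<And>j x. 0 \<le> s j x"
    and s: "\<And>j. j < N \<Longrightarrow> distributed M lborel (\<lambda>\<omega>. Z j \<omega> + Z (Suc j) \<omega>) (\<lambda>x. ennreal (s j x))"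
    by blast
  have s0: "distributed M lborel (\<lambda>\<omega>. Z 0 \<omega> + Z 1 \<omega>) (\<lambda>x. ennreal (s 0 x))"
    using s[of 0] N by simp
  \<comment> \<open>The range starts at \<open>m = 1\<close>, since \<open>W 0\<close> is
    \<open>Z 0\<close> alone and the densities of partial sums are built up from
    \<open>Z 0 + Z 1\<close>.\<close>
  have "\<exists>f :: real \<Rightarrow> real. (\<forall>x. 0 \<le> f x) \<and>
      (1 \<le> m \<and> m \<le> N \<longrightarrow> distributed M lborel (W m) (\<lambda>x. ennreal (f x)))" for m
  proof (cases "1 \<le> m \<and> m \<le> N")
    case True
    then obtain g where "distributed M lborel (W m) g"
      using indep_vars_partial_sum_density[OF ind s0, of m] by (auto simp: W_def[abs_def])
    from distributed_real_density[OF this] show ?thesis by auto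
  qed (auto intro: exI[of _ "\<lambda>_. 0"])
  then have "\<exists>w :: nat \<Rightarrow> real \<Rightarrow> real. \<forall>m. (\<forall>x. 0 \<le> w m x) \<and>
      (1 \<le> m \<and> m \<le> N \<longrightarrow> distributed M lborel (W m) (\<lambda>x. ennreal (w m x)))"
    by (intro choice allI)
  then obtain w :: "nat \<Rightarrow> real \<Rightarrow> real" where w_nn: "\<And>m x. 0 \<le> w m x"
    and w: "\<And>m. 1 \<le> m \<Longrightarrow> m \<le> N \<Longrightarrow> distributed M lborel (W m) (\<lambda>x. ennreal (w m x))"
    by blast
  define R where "R m \<omega> = w m (W m \<omega>) * s m (Z m \<omega> + Z (Suc m) \<omega>)
    / (z m (Z m \<omega>) * w (Suc m) (W (Suc m) \<omega>))" for m \<omega>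
  have R_nn: "0 \<le> R m \<omega>" for m \<omega>
    by (simp add: R_def w_nn s_nn z_nn)
  have R_le: "(\<integral>\<^sup>+\<omega>. ennreal (R m \<omega>) \<partial>M) \<le> 1" if m: "1 \<le> m" "m < N" for m
  proof -
    \<comment> \<open>The block sums are \<open>W (m - 1)\<close>, \<open>Z m\<close> and
      \<open>Z (Suc m)\<close>, taken as \<open>A\<close>, \<open>B\<close>, \<open>C\<close> of the
      ratio bound; then \<open>A + B\<close> is \<open>W m\<close> and \<open>A + B + C\<close> is
      \<open>W (Suc m)\<close>.\<close>
    define K where "K j = (if j = 0 then {..<m} else if j = 1 then {m} else {Suc m})" for j :: nat
    have "indep_vars (\<lambda>_. borel) (\<lambda>j \<omega>. \<Sum>i\<in>K j. Z i \<omega>) {0, 1, 2}"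
      using m by (intro indep_vars_disjoint_sums[OF ind]) (auto simp: disjoint_family_on_def K_def)
    note * = nn_integral_density_ratio_le_1[OF this, of "z m" "w m" "s m" "w (Suc m)"]
    have W1: "(\<Sum>i<m. Z i \<omega>) + Z m \<omega> = W m \<omega>" for \<omega>
      by (simp add: W_def lessThan_Suc_atMost[symmetric])
    show ?thesis
      using * m z[of m] s[of m] w[of m] w[of "Suc m"]
      by (simp add: K_def W1 W_Suc[symmetric] z_nn s_nn w_nn R_def)
  qed
  have meas: "R m \<in> borel_measurable M" if m: "1 \<le> m" "m < N" for m
  proof -
    have [measurable]: "z m \<in> borel_measurable borel" "s m \<in> borel_measurable borel"
      "w m \<in> borel_measurable borel" "w (Suc m) \<in> borel_measurable borel"
      using distributed_real_measurable[OF z_nn z] distributed_real_measurable[OF s_nn s]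
        distributed_real_measurable[OF w_nn w] m by auto
    have [measurable]: "Z m \<in> borel_measurable M" "(\<lambda>\<omega>. Z m \<omega> + Z (Suc m) \<omega>) \<in> borel_measurable M"
      "W m \<in> borel_measurable M" "W (Suc m) \<in> borel_measurable M"
      using distributed_measurable[OF z[of m]] distributed_measurable[OF s[of m]]
        distributed_measurable[OF w[of m]] distributed_measurable[OF w[of "Suc m"]] m by auto
    show ?thesis unfolding R_def[abs_def] by measurable
  qed
  have R_int: "integrable M (R m)" if m: "1 \<le> m" "m < N" for m
    using R_le[OF m] R_nn
    by (intro integrableI_nonneg meas m) (auto simp: less_top[symmetric] top_unique)
  have R_exp: "(\<integral>\<omega>. R m \<omega> \<partial>M) \<le> 1" if m: "1 \<le> m" "m < N" for m
    using R_le[OF m] R_nn nn_integral_eq_integral[OF R_int[OF m]]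
    by (simp add: ennreal_le_1)
  define lz where "lz j \<omega> = ln (z j (Z j \<omega>))" for j \<omega>
  define ls where "ls j \<omega> = ln (s j (Z j \<omega> + Z (Suc j) \<omega>))" for j \<omega>
  define lw where "lw m \<omega> = ln (w m (W m \<omega>))" for m \<omega>
  \<comment> \<open>The telescoped sum of the \<open>ln (R m \<omega>)\<close>, with
    \<open>lw 1\<close> replaced by \<open>ls 0\<close>. No intermediate \<open>lw m\<close> occurs,
    so \<open>D\<close> is integrable.\<close>
  define D where "D \<omega> = ls 0 \<omega> - lw N \<omega> + (\<Sum>m=1..<N. ls m \<omega> - lz m \<omega>)" for \<omega>
  have lz: "integrable M (lz j)" "diff_entropy M (Z j) = - (\<integral>\<omega>. lz j \<omega> \<partial>M)" if "1 \<le> j" "j < N" for j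
    using integrable_ln_density[OF finZ z z_nn] diff_entropy_eq_expectation[OF finZ z z_nn] that
    by (auto simp: lz_def[abs_def])
  have ls: "integrable M (ls j)"
      "diff_entropy M (\<lambda>\<omega>. Z j \<omega> + Z (Suc j) \<omega>) = - (\<integral>\<omega>. ls j \<omega> \<partial>M)" if "j < N" for j
    using integrable_ln_density[OF finS s s_nn] diff_entropy_eq_expectation[OF finS s s_nn] that
    by (auto simp: ls_def[abs_def])
  have finW: "has_finite_diff_entropy M (W N)"
    using finT by (simp add: W_def[abs_def])
  have lw: "integrable M (lw N)" "diff_entropy M (W N) = - (\<integral>\<omega>. lw N \<omega> \<partial>M)"
    using integrable_ln_density[OF finW w w_nn] diff_entropy_eq_expectation[OF finW w w_nn] N
    by (auto simp: lw_def[abs_def])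
  have D_int: "integrable M D"
    unfolding D_def[abs_def] using lz(1) ls(1) lw(1) N
    by (intro Bochner_Integration.integrable_add Bochner_Integration.integrable_diff
        Bochner_Integration.integrable_sum) auto
  \<comment> \<open>\<open>w 1\<close> and \<open>s 0\<close> were chosen separately as densities of
    the same variable, so they agree only almost everywhere.\<close>
  have w1: "AE \<omega> in M. lw 1 \<omega> = ls 0 \<omega>"
  proof -
    have W1: "W 1 = (\<lambda>\<omega>. Z 0 \<omega> + Z 1 \<omega>)" by (auto simp: W_def)
    have "AE x in lborel. ennreal (w 1 x) = ennreal (s 0 x)"
      by (rule distributed_unique[OF w[of 1, unfolded W1]]) (use N s0 in auto)
    \<comment> \<open>The law of \<open>W 1\<close> has a density, so a Lebesgue-null exceptional
      set is also null for it.\<close>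
    then have "AE x in distr M lborel (W 1). w 1 x = s 0 x"
      using w[of 1] N w_nn s_nn by (subst distributed_distr_eq_density[OF w], simp_all)
       (subst AE_density, auto elim!: eventually_mono dest: distributed_borel_measurable)
    then have "AE \<omega> in M. w 1 (W 1 \<omega>) = s 0 (W 1 \<omega>)"
      using distributed_measurable[OF w[of 1]] N by (auto dest: AE_distrD[rotated])
    then show ?thesis
      by eventually_elim (simp add: lw_def ls_def W_def)
  qed
  have "AE \<omega> in M. \<forall>m\<in>{1..<N}. ls m \<omega> - lz m \<omega> + lw m \<omega> - lw (Suc m) \<omega> \<le> R m \<omega> - 1"
  proof (intro AE_finite_allI)
    fix m assume m: "m \<in> {1..<N}"
    \<comment> \<open>All four factors of \<open>R m\<close> must be positive for its logarithm to
      split.\<close>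
    have "AE \<omega> in M. 0 < z m (Z m \<omega>)" "AE \<omega> in M. 0 < s m (Z m \<omega> + Z (Suc m) \<omega>)"
      "AE \<omega> in M. 0 < w m (W m \<omega>)" "AE \<omega> in M. 0 < w (Suc m) (W (Suc m) \<omega>)"
      using m distributed_AE_pos[OF z] distributed_AE_pos[OF s] distributed_AE_pos[OF w] by auto
    then show "AE \<omega> in M. ls m \<omega> - lz m \<omega> + lw m \<omega> - lw (Suc m) \<omega> \<le> R m \<omega> - 1"
    proof eventually_elim
      case (elim \<omega>)
      then have "0 < R m \<omega>" by (simp add: R_def)
      then have "ln (R m \<omega>) \<le> R m \<omega> - 1" by (rule ln_le_minus_one)
      moreover have "ln (R m \<omega>) = ls m \<omega> - lz m \<omega> + lw m \<omega> - lw (Suc m) \<omega>"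
        using elim by (simp add: R_def ln_div ln_mult lz_def ls_def lw_def)
      ultimately show ?case by simp
    qed
  qed simp
  with w1 have "AE \<omega> in M. D \<omega> \<le> (\<Sum>m=1..<N. R m \<omega> - 1)"
  proof eventually_elim
    case (elim \<omega>)
    have "(\<Sum>m=1..<N. lw m \<omega> - lw (Suc m) \<omega>) = lw 1 \<omega> - lw N \<omega>"
      using sum_Suc_diff'[OF N, of "\<lambda>m. - lw m \<omega>"] by simp
    then have "D \<omega> = (\<Sum>m=1..<N. ls m \<omega> - lz m \<omega> + lw m \<omega> - lw (Suc m) \<omega>)"
      using elim(1) by (simp add: D_def sum.distrib sum_subtractf)
    also have "\<dots> \<le> (\<Sum>m=1..<N. R m \<omega> - 1)"
      using elim(2) by (intro sum_mono) auto
    finally show ?case .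
  qed
  then have "(\<integral>\<omega>. D \<omega> \<partial>M) \<le> (\<integral>\<omega>. (\<Sum>m=1..<N. R m \<omega> - 1) \<partial>M)"
    using D_int R_int by (intro integral_mono_AE) auto
  also have "\<dots> = (\<Sum>m=1..<N. (\<integral>\<omega>. R m \<omega> \<partial>M) - 1)"
    using R_int by (subst Bochner_Integration.integral_sum) (auto simp: prob_space)
  also have "\<dots> \<le> 0"
    using R_exp by (intro sum_nonpos) auto
  finally have D_le: "(\<integral>\<omega>. D \<omega> \<partial>M) \<le> 0" .
  have "(\<integral>\<omega>. D \<omega> \<partial>M) = (\<integral>\<omega>. ls 0 \<omega> \<partial>M) - (\<integral>\<omega>. lw N \<omega> \<partial>M)
      + (\<Sum>m=1..<N. (\<integral>\<omega>. ls m \<omega> \<partial>M) - (\<integral>\<omega>. lz m \<omega> \<partial>M))"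
    unfolding D_def using lz(1) ls(1) lw(1) N
    by (subst Bochner_Integration.integral_add)
      (auto intro!: Bochner_Integration.integrable_diff Bochner_Integration.integrable_sum
        simp: Bochner_Integration.integral_sum Bochner_Integration.integral_diff)
  also have "\<dots> = diff_entropy M (W N) + (\<Sum>j=1..<N. diff_entropy M (Z j))
      - (\<Sum>j<N. diff_entropy M (\<lambda>\<omega>. Z j \<omega> + Z (Suc j) \<omega>))"
  proof -
    have "(\<Sum>j<N. diff_entropy M (\<lambda>\<omega>. Z j \<omega> + Z (Suc j) \<omega>)) = (\<Sum>j<N. - (\<integral>\<omega>. ls j \<omega> \<partial>M))"
      using ls by auto
    \<comment> \<open>The term \<open>j = 0\<close> is peeled off because \<open>D\<close> carries
      \<open>ls 0\<close> outside its sum.\<close>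
    also have "\<dots> = - (\<integral>\<omega>. ls 0 \<omega> \<partial>M) + (\<Sum>j=1..<N. - (\<integral>\<omega>. ls j \<omega> \<partial>M))"
      using N by (subst atLeast0LessThan[symmetric], subst sum.atLeast_Suc_lessThan) auto
    finally show ?thesis
      using lz lw by (simp add: sum_subtractf sum_negf)
  qed
  finally show ?thesis
    using D_le by (simp add: W_def[abs_def])
qed


section \<open>Independence of the interleaved sequence\<close>

text \<open>An intersection of events, one for each \<open>Z j\<close>, regroups into rectangle
  events for the pairs. Independence across pairs factors it once, and independence within each pair
  factors every rectangle again.\<close>

lemma indep_vars_interleave:
  fixes Xs Ys :: "nat \<Rightarrow> 'a \<Rightarrow> real"
  assumes ind: "indep_vars (\<lambda>_. borel \<Otimes>\<^sub>M borel) (\<lambda>i \<omega>. (Xs i \<omega>, Ys i \<omega>)) {..n}"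
    and XY: "\<And>i. i \<le> n \<Longrightarrow> indep_var borel (Xs i) borel (Ys i)"
  shows "indep_vars (\<lambda>_. borel) (\<lambda>j. if even j then Xs (j div 2) else Ys (j div 2)) {..Suc (2 * n)}"
proof -
  define Z where "Z j = (if even j then Xs (j div 2) else Ys (j div 2))" for j
  have split: "{..Suc (2 * n)} = (\<lambda>i. 2 * i) ` {..n} \<union> (\<lambda>i. Suc (2 * i)) ` {..n}" (is "_ = ?E \<union> ?O")
  proof (intro equalityI subsetI)
    fix j assume j: "j \<in> {..Suc (2 * n)}"
    show "j \<in> ?E \<union> ?O"
      using j by (cases "even j") (auto elim!: evenE oddE)
  qed auto
  have disj: "?E \<inter> ?O = {}" by (auto, presburger)
  have prod_split: "(\<Prod>j\<le>Suc (2 * n). h j) = (\<Prod>i\<le>n. h (2 * i) * h (Suc (2 * i)))" for h :: "nat \<Rightarrow> real"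
    unfolding split using disj
    by (subst prod.union_disjoint) (auto simp: prod.reindex inj_on_def prod.distrib)
  have rv: "Z j \<in> borel_measurable M" if "j \<in> {..Suc (2 * n)}" for j
  proof -
    have "j div 2 \<le> n" using that by auto
    from XY[OF this] show ?thesis by (auto simp: Z_def dest: indep_var_rv1 indep_var_rv2)
  qed
  have "indep_vars (\<lambda>_. borel) Z {..Suc (2 * n)}"
  \<comment> \<open>The finite product criterion is used with all Borel sets as the
    intersection-stable generator.\<close>
  proof (subst indep_vars_finite[where E = "\<lambda>_. sets borel"])
    show "\<forall>A\<in>{..Suc (2 * n)} \<rightarrow> sets borel. prob (\<Inter>j\<le>Suc (2 * n). Z j -` A j \<inter> space M)
        = (\<Prod>j\<le>Suc (2 * n). prob (Z j -` A j \<inter> space M))"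
    proof
      fix A :: "nat \<Rightarrow> real set" assume A: "A \<in> {..Suc (2 * n)} \<rightarrow> sets borel"
      then have A': "A (2 * i) \<in> sets borel" "A (Suc (2 * i)) \<in> sets borel" if "i \<le> n" for i
        using that by auto
      have "(\<Inter>j\<le>Suc (2 * n). Z j -` A j \<inter> space M)
          = (\<Inter>i\<le>n. (\<lambda>\<omega>. (Xs i \<omega>, Ys i \<omega>)) -` (A (2 * i) \<times> A (Suc (2 * i))) \<inter> space M)"
        unfolding split by (auto simp: Z_def ball_Un)
      also have "prob \<dots> = (\<Prod>i\<le>n. prob ((\<lambda>\<omega>. (Xs i \<omega>, Ys i \<omega>)) -` (A (2 * i) \<times> A (Suc (2 * i))) \<inter> space M))"
        using A' by (intro indep_varsD_finite[OF ind]) auto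
      also have "\<dots> = (\<Prod>i\<le>n. prob (Z (2 * i) -` A (2 * i) \<inter> space M)
          * prob (Z (Suc (2 * i)) -` A (Suc (2 * i)) \<inter> space M))"
        using A' indep_varD[OF XY] by (intro prod.cong) (auto simp: Z_def)
      finally show "prob (\<Inter>j\<le>Suc (2 * n). Z j -` A j \<inter> space M)
          = (\<Prod>j\<le>Suc (2 * n). prob (Z j -` A j \<inter> space M))"
        unfolding prod_split .
    qed
  qed (use rv in \<open>auto simp: Int_stable_def sets.sigma_sets_eq[of borel, simplified]\<close>)
  then show ?thesis by (simp add: Z_def[abs_def])
qed

end

section \<open>Laws and entropies along the interleaved sequence\<close>

theorem mainTheorem12:
  fixes M :: "'a measure" and X Y :: "'a \<Rightarrow> real"
    and Xs Ys :: "nat \<Rightarrow> 'a \<Rightarrow> real" and n :: nat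
  assumes "prob_space M"
    and "prob_space.indep_var M borel X borel Y"
    and "prob_space.indep_vars M (\<lambda>_. borel \<Otimes>\<^sub>M borel) (\<lambda>i \<omega>. (Xs i \<omega>, Ys i \<omega>)) {..n}"
    and "\<And>i. i \<le> n \<Longrightarrow>
           distr M (borel \<Otimes>\<^sub>M borel) (\<lambda>\<omega>. (Xs i \<omega>, Ys i \<omega>))
         = distr M (borel \<Otimes>\<^sub>M borel) (\<lambda>\<omega>. (X \<omega>, Y \<omega>))"
    and "has_finite_diff_entropy M X"
    and "has_finite_diff_entropy M Y"
    and "has_finite_diff_entropy M (\<lambda>\<omega>. X \<omega> + Y \<omega>)"
    and "has_finite_diff_entropy M (\<lambda>\<omega>. \<Sum>i\<le>n. Xs i \<omega> + Ys i \<omega>)"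
  shows "diff_entropy M (\<lambda>\<omega>. \<Sum>i\<le>n. Xs i \<omega> + Ys i \<omega>)
           \<le> (2 * real n + 1) * diff_entropy M (\<lambda>\<omega>. X \<omega> + Y \<omega>)
              - real n * diff_entropy M X - real n * diff_entropy M Y"
proof -
  interpret prob_space M by fact
  note pair_law = assms(4)
  have [measurable]: "X \<in> borel_measurable M" "Y \<in> borel_measurable M"
    and indXY: "distr M borel X \<Otimes>\<^sub>M distr M borel Y = distr M (borel \<Otimes>\<^sub>M borel) (\<lambda>\<omega>. (X \<omega>, Y \<omega>))"
    using assms(2) unfolding indep_var_distribution_eq by auto
  have pair_rv: "(\<lambda>\<omega>. (Xs i \<omega>, Ys i \<omega>)) \<in> measurable M (borel \<Otimes>\<^sub>M borel)" if "i \<le> n" for i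
    using assms(3) that by (auto simp: indep_vars_def)
  have rv: "Xs i \<in> borel_measurable M" "Ys i \<in> borel_measurable M" if "i \<le> n" for i
    using measurable_compose[OF pair_rv[OF that] measurable_fst]
      measurable_compose[OF pair_rv[OF that] measurable_snd] by auto
  have law: "distr M borel (Xs i) = distr M borel X" "distr M borel (Ys i) = distr M borel Y"
    if "i \<le> n" for i
  proof -
    note [measurable] = rv[OF that]
    show "distr M borel (Xs i) = distr M borel X"
      using arg_cong[OF pair_law[OF that], of "\<lambda>L. distr L borel fst"]
      by (simp add: distr_distr comp_def)
    show "distr M borel (Ys i) = distr M borel Y"
      using arg_cong[OF pair_law[OF that], of "\<lambda>L. distr L borel snd"]
      by (simp add: distr_distr comp_def)
  qed
  \<comment> \<open>The joint law of the copy is that of \<open>(X, Y)\<close>, a product of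
    marginals which are also the marginals of the copy.\<close>
  have ind_pair: "indep_var borel (Xs i) borel (Ys i)" if "i \<le> n" for i
    unfolding indep_var_distribution_eq
    using rv[OF that] law[OF that] pair_law[OF that] indXY by simp
  define Z where "Z j = (if even j then Xs (j div 2) else Ys (j div 2))" for j
  \<comment> \<open>The last index: \<open>Z 0\<close> to \<open>Z N\<close> are the
    \<open>2 * n + 2\<close> variables, giving \<open>2 * n + 1\<close> adjacent sums.\<close>
  define N where "N = Suc (2 * n)"
  have indZ: "indep_vars (\<lambda>_. borel) Z {..N}"
    unfolding Z_def[abs_def] N_def by (rule indep_vars_interleave[OF assms(3) ind_pair])
  have rvZ: "Z j \<in> borel_measurable M" if "j \<le> N" for j
    using that rv[of "j div 2"] by (auto simp: Z_def N_def)
  have lawZ: "distr M borel (Z j) = (if even j then distr M borel X else distr M borel Y)" if "j \<le> N" for j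
    using that law[of "j div 2"] by (auto simp: Z_def N_def)
  have lawS: "distr M borel (\<lambda>\<omega>. Z j \<omega> + Z (Suc j) \<omega>) = distr M borel (\<lambda>\<omega>. X \<omega> + Y \<omega>)" if j: "j < N" for j
  proof -
    have "indep_vars (\<lambda>_. borel) Z (insert j {Suc j})"
      using j by (intro indep_vars_subset[OF indZ]) auto
    then have "indep_var borel (Z j) borel (Z (Suc j))"
      using indep_vars_sum[of "{Suc j}" j Z] by simp
    then have "distr M borel (\<lambda>\<omega>. Z j \<omega> + Z (Suc j) \<omega>)
        = convolution (distr M borel (Z j)) (distr M borel (Z (Suc j)))"
      using j rvZ by (intro sum_indep_random_variable) auto
    \<comment> \<open>For odd \<open>j\<close> the neighbours are some \<open>Ys i\<close> and the
      next \<open>Xs\<close>, from different pairs, and commutativity restores the order.\<close>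
    also have "\<dots> = convolution (distr M borel X) (distr M borel Y)"
      using j lawZ[of j] lawZ[of "Suc j"]
      by (auto intro!: convolution_commutative finite_measure_distr)
    also have "\<dots> = distr M borel (\<lambda>\<omega>. X \<omega> + Y \<omega>)"
      by (rule sum_indep_random_variable[symmetric]) (use assms(2) in auto)
    finally show ?thesis .
  qed
  have entZ: "diff_entropy M (Z j) = (if even j then diff_entropy M X else diff_entropy M Y)"
    and finZ: "has_finite_diff_entropy M (Z j)" if "j \<le> N" for j
    using diff_entropy_cong_law[OF rvZ[OF that], of X] diff_entropy_cong_law[OF rvZ[OF that], of Y]
      has_finite_diff_entropy_cong_law[OF rvZ[OF that], of X]
      has_finite_diff_entropy_cong_law[OF rvZ[OF that], of Y]
      lawZ[OF that] assms(5,6) by (cases "even j"; simp)+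
  have entS: "diff_entropy M (\<lambda>\<omega>. Z j \<omega> + Z (Suc j) \<omega>) = diff_entropy M (\<lambda>\<omega>. X \<omega> + Y \<omega>)"
    and finS: "has_finite_diff_entropy M (\<lambda>\<omega>. Z j \<omega> + Z (Suc j) \<omega>)" if "j < N" for j
    using diff_entropy_cong_law[OF _ _ lawS[OF that]] has_finite_diff_entropy_cong_law[OF _ _ lawS[OF that]]
      rvZ[of j] rvZ[of "Suc j"] that assms(7) by auto
  have sumZ: "(\<Sum>j\<le>N. Z j \<omega>) = (\<Sum>i\<le>n. Xs i \<omega> + Ys i \<omega>)" for \<omega>
    unfolding N_def by (induction n) (auto simp: Z_def)
  have "(\<Sum>j=1..<N. diff_entropy M (Z j)) = (\<Sum>j=1..<N. if even j then diff_entropy M X else diff_entropy M Y)"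
    using entZ by (intro sum.cong) auto
  \<comment> \<open>The interior indices \<open>1\<close> to \<open>2 * n\<close> contain
    \<open>n\<close> even ones, carrying \<open>X\<close>, and \<open>n\<close> odd ones, carrying
    \<open>Y\<close>.\<close>
  also have "\<dots> = real n * diff_entropy M X + real n * diff_entropy M Y"
    unfolding N_def by (induction n) (auto simp: algebra_simps)
  finally have sum_ent: "(\<Sum>j=1..<N. diff_entropy M (Z j))
      = real n * diff_entropy M X + real n * diff_entropy M Y" .
  have "diff_entropy M (\<lambda>\<omega>. \<Sum>j\<le>N. Z j \<omega>) + (\<Sum>j=1..<N. diff_entropy M (Z j))
      \<le> (\<Sum>j<N. diff_entropy M (\<lambda>\<omega>. Z j \<omega> + Z (Suc j) \<omega>))"
  proof (rule diff_entropy_sum_chain[OF indZ])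
    show "has_finite_diff_entropy M (\<lambda>\<omega>. \<Sum>j\<le>N. Z j \<omega>)"
      using assms(8) by (simp only: sumZ)
  qed (use finZ finS in \<open>auto simp: N_def\<close>)
  also have "\<dots> = (2 * real n + 1) * diff_entropy M (\<lambda>\<omega>. X \<omega> + Y \<omega>)"
    using entS by (simp add: N_def algebra_simps)
  finally show ?thesis
    unfolding sumZ sum_ent by simp
qed

end
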